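(* Let $\lambda\in(1/2,1)$ be the reciprocal of a Garsia number. Let $X=[0,1]^2$, $S_0(x)=\lambda x$, $S_1(x)=\lambda x+(1-\lambda,0)$, $C=\{0\}\times[0,1]$, and let $F_C^\lambda$ be the unique non-empty compact set satisfying $F_C^\lambda=S_0(F_C^\lambda)\cup S_1(F_C^\lambda)\cup C$. Then, as $\delta\to0$, \[ \frac{\log N_\delta(F_C^\lambda)}{-\log\delta}=\frac{\log(4\lambda)}{\log 2}+O\Big(\frac{1}{-\log\delta}\Big). \]
   Context: A Garsia number is a positive real algebraic integer with norm $\pm2$ all of whose Galois conjugates have modulus strictly greater than $1$. For bounded $E\subseteq\mathbb{R}^2$ and $\delta>0$, $N_\delta(E)$ is the number of half-open squares (products of half-open intervals $[a,b)$) of the $\delta$-mesh aligned with the coordinate axes that intersect $E$. *)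

theory Defs
  imports "HOL-Analysis.Analysis" "HOL-Computational_Algebra.Computational_Algebra"
    "HOL-Library.Landau_Symbols"
begin

text \<open>Garsia number: a positive real algebraic integer with norm +-2 all of whose
  Galois conjugates have modulus > 1.  We write this out via the minimal polynomial
  p (monic, irreducible in Z[x]); the conjugates are the complex roots of p and the
  norm is the product of the conjugates, i.e. +-(constant coefficient of p).\<close>
definition garsia_number :: "real \<Rightarrow> bool" where
  "garsia_number x \<longleftrightarrow> x > 0 \<and>
     (\<exists>p :: int poly. lead_coeff p = 1 \<and> irreducible p \<and>
        poly (map_poly real_of_int p) x = 0 \<and>
        \<bar>coeff p 0\<bar> = 2 \<and>
        (\<forall>z :: complex. poly (map_poly of_int p) z = 0 \<longrightarrow> cmod z > 1))"

definition mesh_count :: "real \<Rightarrow> (real \<times> real) set \<Rightarrow> nat" where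
  "mesh_count \<delta> E = card {(i, j). \<exists>p \<in> E.
      real_of_int i * \<delta> \<le> fst p \<and> fst p < (real_of_int i + 1) * \<delta> \<and>
      real_of_int j * \<delta> \<le> snd p \<and> snd p < (real_of_int j + 1) * \<delta>}"

definition S0 :: "real \<Rightarrow> real \<times> real \<Rightarrow> real \<times> real" where
  "S0 l = (\<lambda>(x, y). (l * x, l * y))"

definition S1 :: "real \<Rightarrow> real \<times> real \<Rightarrow> real \<times> real" where
  "S1 l = (\<lambda>(x, y). (l * x + (1 - l), l * y))"

definition condC :: "(real \<times> real) set" where
  "condC = {0} \<times> {0..1}"

end

theory Submission
  imports Defs "Jordan_Normal_Form.Char_Poly"
begin

text \<open>The set is the union of \<open>[0,1] \<times> {0}\<close> with vertical segments of height \<open>l^n\<close> over the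
  \<open>2^n\<close> points \<open>(1 - l) * (\<Sum>k\<in>A. l^k)\<close>, \<open>A \<subseteq> {..<n}\<close>. Levels with \<open>2^n \<le> 1/\<delta>\<close> meet
  at most a constant times \<open>(2l)^n / \<delta>\<close> squares, and everything of higher level lies in a strip of
  height \<open>l^N\<close> with \<open>2^N \<approx> 1/\<delta>\<close>; the total is of order \<open>l^N / \<delta>^2\<close>. For
  the matching lower bound the points of level \<open>N\<close> must lie in about \<open>2^N\<close> distinct columns.
  This is Garsia's separation lemma: if \<open>q \<noteq> 0\<close> has coefficients in \<open>{-1,0,1}\<close> and
  degree less than \<open>n\<close>, then the norm of \<open>q(1/l)\<close> is a nonzero integer, the conjugate factors are at
  most constants times \<open>\<bar>z\<bar>^n\<close>, and the conjugates other than \<open>1/l\<close> have product of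
  modulus \<open>2l\<close>, so \<open>l^n * \<bar>q(1/l)\<bar>\<close> is at least a constant times \<open>2^-n\<close>.\<close>

subsection \<open>Garsia's separation lemma\<close>

lemma monic_int_poly_division:
  fixes p f :: "int poly"
  assumes "lead_coeff p = 1"
  obtains q r where "f = p * q + r" "r = 0 \<or> degree r < degree p"
proof -
  have "p \<noteq> 0" using assms by auto
  from pseudo_divmod[OF this, of f "fst (pseudo_divmod f p)" "snd (pseudo_divmod f p)"] assms
  show thesis by (intro that) auto
qed

lemma irreducible_int_poly_dvd:
  fixes p f :: "int poly" and z :: complex
  assumes p: "lead_coeff p = 1" "irreducible p" "poly (map_poly of_int p) z = 0"
    and f: "poly (map_poly of_int f) z = 0"
  shows "p dvd f"
proof -
  \<comment> \<open>A polynomial \<open>g\<close> of least degree vanishing at \<open>z\<close> pseudo-divides \<open>p\<close>; primality of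
    \<open>p\<close> then replaces the appeal to Gauss's lemma.\<close>
  define V where "V g \<longleftrightarrow> g \<noteq> 0 \<and> poly (map_poly of_int g) z = 0" for g :: "int poly"
  have "V p" using p by (auto simp: V_def)
  then obtain g where g: "V g" and gmin: "\<And>h. V h \<Longrightarrow> degree g \<le> degree h"
    using ex_has_least_nat[of V p degree] by blast
  have g0: "g \<noteq> 0" and gz: "poly (map_poly of_int g) z = 0" using g by (auto simp: V_def)
  from pseudo_mod[OF g0, of p] obtain a q
    where aq: "a \<noteq> 0" "Polynomial.smult a p = g * q + pseudo_mod p g"
      and deg: "pseudo_mod p g = 0 \<or> degree (pseudo_mod p g) < degree g" by blast
  define r where "r = pseudo_mod p g"
  have "map_poly of_int (Polynomial.smult a p) = (map_poly of_int (g * q + r) :: complex poly)"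
    using aq r_def by simp
  hence "poly (map_poly of_int r) z = 0"
    using p(3) gz by (auto simp: hom_distribs dest: arg_cong[of _ _ "\<lambda>f. poly f z"])
  hence "r = 0" using gmin[of r] deg by (force simp: V_def r_def)
  hence eq: "Polynomial.smult a p = g * q" using aq r_def by simp
  have "prime_elem p" using p(2) by (rule irreducible_imp_prime_elem)
  moreover have "p dvd g * q" unfolding eq[symmetric] by (simp add: dvd_smult)
  ultimately have "p dvd g \<or> p dvd q" by (rule prime_elem_dvd_multD)
  \<comment> \<open>If \<open>p\<close> divided \<open>q\<close>, cancelling it would leave the
    nonzero constant \<open>a\<close> as a multiple of \<open>g\<close>, which vanishes at
    \<open>z\<close>.\<close>
  moreover have "\<not> p dvd q"
  proof
    assume "p dvd q"
    then obtain q' where "q = p * q'" by blast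
    hence "p * [:a:] = p * (g * q')" using eq by (simp add: mult_ac)
    hence "[:a:] = g * q'" using p(1) by (metis mult_cancel_left leading_coeff_0_iff zero_neq_one)
    hence "map_poly of_int [:a:] = (map_poly of_int (g * q') :: complex poly)" by simp
    hence "(of_int a :: complex) = 0"
      using gz by (auto simp: hom_distribs dest: arg_cong[of _ _ "\<lambda>f. poly f z"])
    thus False using aq(1) by simp
  qed
  ultimately have "p dvd g" by blast
  \<comment> \<open>As \<open>p\<close> divides \<open>g\<close>, it too has least degree in
    \<open>V\<close>. Being monic, it allows true division with remainder, so the remainder of
    \<open>f\<close> must vanish.\<close>
  hence pmin: "degree p \<le> degree h" if "V h" for h
    using gmin[OF that] dvd_imp_degree_le[of p g] g0 by auto
  obtain s t where st: "f = p * s + t" "t = 0 \<or> degree t < degree p"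
    using monic_int_poly_division[OF p(1)] by blast
  have "poly (map_poly of_int t) z = 0"
    using f p(3) by (simp add: st hom_distribs)
  hence "t = 0" using pmin[of t] st by (force simp: V_def)
  thus ?thesis using st by simp
qed

text \<open>A double root would also be a root of \<open>pderiv p\<close>, so \<open>p\<close> would
  divide a nonzero polynomial of smaller degree. Simple roots let the norm be written as a product
  over the set of conjugates, without multiplicities.\<close>

lemma irreducible_int_poly_rsquarefree:
  fixes p :: "int poly"
  assumes p: "lead_coeff p = 1" "irreducible p"
  shows "rsquarefree (map_poly of_int p :: complex poly)"
  unfolding rsquarefree_roots
proof (intro allI notI, elim conjE)
  fix z :: complex
  assume z: "poly (map_poly of_int p) z = 0" "poly (pderiv (map_poly of_int p)) z = 0"
  have "p dvd pderiv p"
    by (rule irreducible_int_poly_dvd[OF p z(1)]) (use z(2) in \<open>simp add: of_int_hom.map_poly_pderiv\<close>)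
  have "degree p \<noteq> 0"
  proof
    assume "degree p = 0"
    hence "p = 1" using p(1) by (metis degree_eq_zeroE coeff_pCons_0 pCons_one)
    thus False using z by simp
  qed
  hence "pderiv p \<noteq> 0" by (simp add: pderiv_eq_0_iff)
  from dvd_imp_degree_le[OF \<open>p dvd pderiv p\<close> this] \<open>degree p \<noteq> 0\<close> show False
    by (simp add: degree_pderiv)
qed

section \<open>Integrality of norms through a Vandermonde matrix\<close>

text \<open>A nonzero kernel vector would be the coefficient list of a nonzero polynomial of degree
  below \<open>d\<close> with \<open>d\<close> distinct roots.\<close>

lemma vandermonde_det_nonzero:
  fixes z :: "nat \<Rightarrow> 'a :: field"
  assumes inj: "inj_on z {..<d}"
  shows "Determinant.det (mat d d (\<lambda>(i, j). z i ^ j)) \<noteq> 0"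
proof
  let ?V = "mat d d (\<lambda>(i, j). z i ^ j)"
  assume "Determinant.det ?V = 0"
  then obtain v where v: "v \<in> carrier_vec d" "v \<noteq> 0\<^sub>v d" "?V *\<^sub>v v = 0\<^sub>v d"
    using det_0_iff_vec_prod_zero[of ?V d] by auto
  define f where "f = (\<Sum>j<d. monom (vec_index v j) j)"
  have coeff: "coeff f j = (if j < d then vec_index v j else 0)" for j
    by (simp add: f_def coeff_sum)
  have root: "poly f (z i) = 0" if "i < d" for i
  proof -
    have "vec_index (?V *\<^sub>v v) i = (\<Sum>j<d. z i ^ j * vec_index v j)"
      using that v(1) by (simp add: scalar_prod_def lessThan_atLeast0)
    thus ?thesis using that v(3) by (simp add: f_def poly_sum poly_monom mult.commute)
  qed
  have "f = 0"
  proof (rule ccontr)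
    assume "f \<noteq> 0"
    hence "degree f < d" using coeff by (metis leading_coeff_0_iff)
    have "card (z ` {..<d}) \<le> card {x. poly f x = 0}"
      using root by (intro card_mono poly_roots_finite \<open>f \<noteq> 0\<close>) auto
    also have "\<dots> \<le> degree f" by (rule card_poly_roots_bound[OF \<open>f \<noteq> 0\<close>])
    finally show False using \<open>degree f < d\<close> by (simp add: card_image[OF inj])
  qed
  hence "vec_index v j = 0" if "j < d" for j using coeff[of j] that by simp
  hence "v = 0\<^sub>v d" using v(1) by (intro eq_vecI) auto
  thus False using v(2) by simp
qed

text \<open>The product is the determinant of the integer matrix of multiplication by \<open>q\<close>
  modulo \<open>p\<close>, which the Vandermonde matrix of the roots diagonalizes.\<close>

lemma prod_roots_in_Ints:
  fixes p q :: "int poly"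
  defines "Z \<equiv> {z :: complex. poly (map_poly of_int p) z = 0}"
  assumes monic: "lead_coeff p = 1" and card: "card Z = degree p"
  shows "(\<Prod>z\<in>Z. poly (map_poly of_int q) z) \<in> \<int>"
proof -
  define d where "d = degree p"
  have "p \<noteq> 0" using monic by auto
  hence "finite Z" unfolding Z_def by (intro poly_roots_finite) simp
  then obtain z where z: "bij_betw z {..<d} Z"
    using ex_bij_betw_nat_finite[of Z] card by (auto simp: d_def lessThan_atLeast0)
  have "\<exists>r. (r = 0 \<or> degree r < d) \<and> (\<exists>s. monom 1 j * q = p * s + r)" for j
    by (rule monic_int_poly_division[OF monic, of "monom 1 j * q"]) (auto simp: d_def)
  then obtain r where r: "\<And>j. r j = 0 \<or> degree (r j) < d" "\<And>j. \<exists>s. monom 1 j * q = p * s + r j"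
    by metis
  have rz: "poly (map_poly of_int (r j)) x = x ^ j * poly (map_poly of_int q) x" if "x \<in> Z" for x j
  proof -
    obtain s where "monom 1 j * q = p * s + r j" using r(2) by blast
    hence "map_poly of_int (monom 1 j * q) = (map_poly of_int (p * s + r j) :: complex poly)"
      by simp
    from arg_cong[OF this, of "\<lambda>f. poly f x"] that show ?thesis
      by (simp add: hom_distribs Z_def poly_monom)
  qed
  define V where "V = mat d d (\<lambda>(i, j). z i ^ j)"
  define D where "D = mat d d (\<lambda>(i, j). if i = j then poly (map_poly of_int q) (z i) else 0)"
  \<comment> \<open>Column \<open>j\<close> lists the coefficients of \<open>monom 1 j * q\<close>
    reduced modulo \<open>p\<close>. Evaluating them at the root \<open>z i\<close> gives
    \<open>z i ^ j\<close> times the value of \<open>q\<close> there, which is the identity between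
    \<open>D * V\<close> and \<open>V\<close> times \<open>N\<close>.\<close>
  define N where "N = mat d d (\<lambda>(k, j). coeff (r j) k)"
  have carr: "V \<in> carrier_mat d d" "D \<in> carrier_mat d d" "map_mat of_int N \<in> carrier_mat d d"
    by (auto simp: V_def D_def N_def)
  have "D * V = V * map_mat of_int N"
  proof (rule eq_matI)
    fix i j assume "i < dim_row (V * map_mat of_int N)" "j < dim_col (V * map_mat of_int N)"
    hence ij: "i < d" "j < d" by (auto simp: V_def N_def)
    hence zi: "z i \<in> Z" using z by (auto simp: bij_betw_def)
    have "(D * V) $$ (i, j) = (\<Sum>k<d. if k = i then poly (map_poly of_int q) (z i) * z k ^ j else 0)"
      using ij by (auto simp: D_def V_def scalar_prod_def lessThan_atLeast0
          if_distrib[of "\<lambda>x. x * _"] cong: if_cong)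
    also have "\<dots> = poly (map_poly of_int (r j)) (z i)"
      using ij rz[OF zi] by simp
    also have "\<dots> = (\<Sum>k<d. of_int (coeff (r j) k) * z i ^ k)"
    \<comment> \<open>The remainder may be \<open>0\<close>, whose degree is \<open>0\<close> by
      convention; this lies below \<open>d\<close> only when \<open>d\<close> is positive.\<close>
    proof (cases "d = 0")
      case False
      hence "degree (r j) < d" using r(1)[of j] by auto
      thus ?thesis unfolding poly_altdef
        by (intro sum.mono_neutral_cong_left) (auto simp: coeff_eq_0)
    qed (use ij in auto)
    also have "\<dots> = (V * map_mat of_int N) $$ (i, j)"
      using ij by (auto simp: N_def V_def scalar_prod_def lessThan_atLeast0 intro!: sum.cong)
    finally show "(D * V) $$ (i, j) = (V * map_mat of_int N) $$ (i, j)" .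
  qed (auto simp: V_def D_def N_def)
  hence "Determinant.det D * Determinant.det V = Determinant.det V * of_int (Determinant.det N)"
    using det_mult[OF carr(2,1)] det_mult[OF carr(1,3)] by (metis of_int_hom.hom_det)
  moreover have "Determinant.det V \<noteq> 0"
    unfolding V_def using z by (intro vandermonde_det_nonzero) (auto simp: bij_betw_def)
  ultimately have "Determinant.det D = of_int (Determinant.det N)" by simp
  moreover have "Determinant.det D = (\<Prod>i<d. poly (map_poly of_int q) (z i))"
    using det_upper_triangular[OF _ carr(2)]
    by (auto simp: D_def prod_list_diag_prod lessThan_atLeast0 upper_triangular_def)
  moreover have "\<dots> = (\<Prod>x\<in>Z. poly (map_poly of_int q) x)"
    by (rule prod.reindex_bij_betw[OF z])
  ultimately show ?thesis by simp
qed

section \<open>Lower bounds for polynomials with coefficients in {-1, 0, 1}\<close>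

text \<open>The constant digit of \<open>q\<close> is a multiple of the even
  \<open>coeff p 0\<close>, hence \<open>0\<close>. The cofactor then has constant term
  \<open>0\<close> as well, so the variable cancels on both sides and induction applies.
  Consequently no conjugate is a root of a nonzero \<open>q\<close>.\<close>

lemma even_const_dvd_signed_digit_poly:
  fixes p q :: "int poly"
  assumes "p dvd q" "even (coeff p 0)" "coeff p 0 \<noteq> 0" "\<And>k. coeff q k \<in> {-1, 0, 1}"
  shows "q = 0"
  using assms(1,4)
proof (induction q)
  case (pCons a q)
  obtain r where r: "pCons a q = p * r" using pCons.prems(1) by blast
  hence "a = coeff p 0 * coeff r 0" by (metis coeff_mult_0 coeff_pCons_0)
  hence "even a" using assms(2) by simp
  hence a: "a = 0" using pCons.prems(2)[of 0] by auto
  hence "coeff r 0 = 0" using \<open>a = coeff p 0 * coeff r 0\<close> assms(3) by simp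
  then obtain r' where "r = pCons 0 r'" by (metis coeff_pCons_0 pCons_cases)
  with r a have "p dvd q" by simp
  hence "q = 0" using pCons.prems(2)[of "Suc _"] by (intro pCons.IH) auto
  thus ?case using a by simp
qed simp


text \<open>The product of the values of \<open>q\<close> over all conjugates is a nonzero integer.
  The threshold \<open>D * (b / 2) ^ n\<close> is the reciprocal of an upper bound for the part of
  that product away from \<open>b\<close>.\<close>

lemma garsia_poly_lower_bound:
  assumes "garsia_number b"
  obtains D where "D > 0" "\<And>n q. (\<And>k. coeff q k \<in> {-1, 0, 1}) \<Longrightarrow> q \<noteq> 0 \<Longrightarrow> degree q < n \<Longrightarrow>
    D * (b / 2) ^ n \<le> \<bar>poly (map_poly of_int q) b\<bar>"
proof -
  obtain p where b: "b > 0" and p: "lead_coeff p = 1" "irreducible p"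
    and root: "poly (map_poly real_of_int p) b = 0" and const: "\<bar>coeff p 0\<bar> = 2"
    and conj: "\<And>z :: complex. poly (map_poly of_int p) z = 0 \<Longrightarrow> cmod z > 1"
    using assms unfolding garsia_number_def by blast
  define P where "P = (map_poly of_int p :: complex poly)"
  define Z where "Z = {z. poly P z = 0}"
  have of_real_poly: "poly (map_poly of_int f) (complex_of_real x) =
      of_real (poly (map_poly real_of_int f) x)" for f x
    by (induction f) (auto simp: map_poly_pCons)
  have "lead_coeff P = 1" using p(1) by (simp add: P_def)
  have "rsquarefree P" unfolding P_def by (rule irreducible_int_poly_rsquarefree[OF p])
  from complex_poly_decompose_rsquarefree[OF this]
  have P_prod: "P = (\<Prod>z\<in>Z. [:-z, 1:])" using \<open>lead_coeff P = 1\<close> by (simp add: Z_def)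
  have "P \<noteq> 0" using \<open>lead_coeff P = 1\<close> by auto
  hence finZ: "finite Z" unfolding Z_def by (rule poly_roots_finite)
  have "degree P = card Z" by (subst P_prod, subst degree_prod_eq_sum_degree) auto
  hence cardZ: "card Z = degree p" by (simp add: P_def)
  have "poly P 0 = (\<Prod>z\<in>Z. -z)" by (subst P_prod) (simp add: poly_prod)
  moreover have "cmod (poly P 0) = 2"
    using const by (simp add: P_def poly_0_coeff_0)
  ultimately have norm2: "(\<Prod>z\<in>Z. cmod z) = 2" by (simp add: prod_norm[symmetric])
  define \<beta> where "\<beta> = complex_of_real b"
  have \<beta>: "\<beta> \<in> Z" using root by (simp add: Z_def \<beta>_def P_def of_real_poly)
  have Zgt: "cmod z > 1" if "z \<in> Z" for z using conj that by (simp add: Z_def P_def)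
  \<comment> \<open>These factors are the denominators of the geometric sums that bound
    \<open>q\<close> at the other conjugates. They are positive because all conjugates lie outside
    the closed unit disc.\<close>
  define D where "D = (\<Prod>z\<in>Z-{\<beta>}. cmod z - 1)"
  have "D > 0" unfolding D_def using Zgt by (intro prod_pos) force
  show thesis
  proof (rule that[OF \<open>D > 0\<close>])
    fix n and q :: "int poly"
    assume q: "\<And>k. coeff q k \<in> {-1, 0, 1}" "q \<noteq> 0" "degree q < n"
    let ?q = "\<lambda>z :: complex. poly (map_poly of_int q) z"
    have nz: "?q z \<noteq> 0" if "z \<in> Z" for z
    proof
      assume "?q z = 0"
      hence "p dvd q" using that
        by (intro irreducible_int_poly_dvd[OF p, of z]) (auto simp: Z_def P_def)
      moreover have "even (coeff p 0)" "coeff p 0 \<noteq> 0" using const by presburger+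
      ultimately show False using even_const_dvd_signed_digit_poly q by blast
    qed
    have "(\<Prod>z\<in>Z. ?q z) \<in> \<int>"
      unfolding Z_def P_def by (rule prod_roots_in_Ints) (use p(1) cardZ in \<open>auto simp: Z_def P_def\<close>)
    then obtain m :: int where m: "(\<Prod>z\<in>Z. ?q z) = of_int m" by (auto elim: Ints_cases)
    have "m \<noteq> 0" using m nz finZ by (metis of_int_0 prod_zero_iff)
    hence "1 \<le> cmod (\<Prod>z\<in>Z. ?q z)" by (simp add: m)
    also have "\<dots> = cmod (?q \<beta>) * (\<Prod>z\<in>Z-{\<beta>}. cmod (?q z))"
      using finZ \<beta> by (simp add: prod_norm prod.remove norm_mult)
    also have "\<dots> \<le> cmod (?q \<beta>) * (\<Prod>z\<in>Z-{\<beta>}. cmod z ^ n / (cmod z - 1))"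
    proof (intro mult_left_mono prod_mono conjI)
      fix z assume "z \<in> Z - {\<beta>}"
      hence z: "cmod z > 1" using Zgt by auto
      have "cmod (?q z) \<le> (\<Sum>k\<le>degree q. cmod (of_int (coeff q k) * z ^ k))"
        unfolding poly_altdef by (simp add: norm_sum)
      also have "\<dots> \<le> (\<Sum>k\<le>degree q. cmod z ^ k)"
      proof (rule sum_mono)
        fix k
        have "cmod (of_int (coeff q k)) \<le> 1" using q(1)[of k] by auto
        thus "cmod (of_int (coeff q k) * z ^ k) \<le> cmod z ^ k"
          by (simp add: norm_mult norm_power mult_left_le_one_le)
      qed
      also have "\<dots> \<le> (\<Sum>k<n. cmod z ^ k)"
        using q(3) by (intro sum_mono2) auto
      also have "\<dots> = (cmod z ^ n - 1) / (cmod z - 1)"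
        using z by (simp add: geometric_sum)
      also have "\<dots> \<le> cmod z ^ n / (cmod z - 1)"
        using z by (intro divide_right_mono) auto
      finally show "cmod (?q z) \<le> cmod z ^ n / (cmod z - 1)" .
    qed auto
    also have "(\<Prod>z\<in>Z-{\<beta>}. cmod z ^ n / (cmod z - 1)) = (2 / b) ^ n / D"
    proof -
      have "b * (\<Prod>z\<in>Z-{\<beta>}. cmod z) = 2"
        using norm2 finZ \<beta> b by (simp add: prod.remove \<beta>_def)
      hence "(\<Prod>z\<in>Z-{\<beta>}. cmod z) = 2 / b" using b by (simp add: field_simps)
      thus ?thesis by (simp add: D_def prod_dividef prod_power_distrib[symmetric])
    qed
    also have "cmod (?q \<beta>) = \<bar>poly (map_poly of_int q) b\<bar>"
      by (simp add: \<beta>_def of_real_poly)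
    finally show "D * (b / 2) ^ n \<le> \<bar>poly (map_poly of_int q) b\<bar>"
      using \<open>D > 0\<close> b by (simp add: field_simps power_divide)
  qed
qed

text \<open>A difference of two digit sums has digits in {-1, 0, 1}. The factor
  \<open>l ^ n / l\<close>, which passes from powers of \<open>1 / l\<close> to powers of
  \<open>l\<close>, cancels \<open>(1 / l) ^ n\<close> in the bound and leaves
  \<open>D / l / 2 ^ n\<close>.\<close>

lemma garsia_digit_sums_separated:
  assumes "garsia_number (1 / l)"
  obtains c where "c > 0"
    "\<And>n A B. A \<subseteq> {..<n} \<Longrightarrow> B \<subseteq> {..<n} \<Longrightarrow> A \<noteq> B \<Longrightarrow>
       c / 2 ^ n \<le> \<bar>(\<Sum>k\<in>A. l ^ k) - (\<Sum>k\<in>B. l ^ k)\<bar>"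
proof -
  have l: "l > 0" using assms by (simp add: garsia_number_def)
  obtain D where D: "D > 0" "\<And>n q. (\<And>k. coeff q k \<in> {-1, 0, 1}) \<Longrightarrow> q \<noteq> 0 \<Longrightarrow> degree q < n \<Longrightarrow>
      D * (1 / l / 2) ^ n \<le> \<bar>poly (map_poly of_int q) (1 / l)\<bar>"
    using garsia_poly_lower_bound[OF assms] by blast
  show thesis
  proof (rule that)
    show "D / l > 0" using D(1) l by simp
  next
    fix n :: nat and A B :: "nat set"
    assume AB: "A \<subseteq> {..<n}" "B \<subseteq> {..<n}" "A \<noteq> B"
    \<comment> \<open>Digits are reversed because the Garsia property concerns the conjugates of \<open>1 / l\<close>:
      \<open>\<Sum>k<n. e k * l^k\<close> equals \<open>l^n / l * q(1/l)\<close>.\<close>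
    define e :: "nat \<Rightarrow> int" where "e k = of_bool (k \<in> A) - of_bool (k \<in> B)" for k
    define q where "q = (\<Sum>k<n. monom (e (n - 1 - k)) k)"
    have coeff: "coeff q k = (if k < n then e (n - 1 - k) else 0)" for k
      by (simp add: q_def coeff_sum)
    obtain k where k: "k < n" "e k \<noteq> 0" 
    proof -
      obtain k where "(k \<in> A) \<noteq> (k \<in> B)" using AB(3) by blast
      with AB(1,2) show thesis by (intro that[of k]) (auto simp: e_def)
    qed
    hence "coeff q (n - 1 - k) \<noteq> 0" by (simp add: coeff)
    hence "q \<noteq> 0" by auto
    moreover from this have "degree q < n" using coeff by (metis leading_coeff_0_iff)
    moreover have "coeff q k \<in> {-1, 0, 1}" for k by (simp add: coeff e_def)
    ultimately have "D * (1 / l / 2) ^ n \<le> \<bar>poly (map_poly of_int q) (1 / l)\<bar>"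
      by (rule D(2)[rotated])
    hence "l ^ n / l * (D * (1 / l / 2) ^ n) \<le> l ^ n / l * \<bar>poly (map_poly of_int q) (1 / l)\<bar>"
      using l by (intro mult_left_mono) auto
    also have "\<dots> = \<bar>l ^ n / l * poly (map_poly of_int q) (1 / l)\<bar>"
      using l by (simp add: abs_mult)
    also have "l ^ n / l * poly (map_poly of_int q) (1 / l) = (\<Sum>k<n. e (n - 1 - k) * (l ^ n / l * (1 / l) ^ k))"
      unfolding q_def by (simp add: hom_distribs poly_sum poly_monom sum_distrib_left mult_ac)
    also have "\<dots> = (\<Sum>k<n. e (n - 1 - k) * l ^ (n - 1 - k))"
    proof (intro sum.cong refl)
      fix k assume "k \<in> {..<n}"
      hence "n = Suc (n - 1 - k) + k" by simp
      hence "l ^ n = l ^ (n - 1 - k) * l * l ^ k" by (metis power_Suc2 power_add)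
      thus "e (n - 1 - k) * (l ^ n / l * (1 / l) ^ k) = e (n - 1 - k) * l ^ (n - 1 - k)"
        using l by (simp add: field_simps)
    qed
    also have "\<dots> = (\<Sum>k<n. e k * l ^ k)"
      using sum.nat_diff_reindex[of "\<lambda>k. e k * l ^ k" n] by simp
    also have "\<dots> = (\<Sum>k\<in>A. l ^ k) - (\<Sum>k\<in>B. l ^ k)"
    proof -
      have "(\<Sum>k<n. of_bool (k \<in> C) * l ^ k) = (\<Sum>k\<in>C. l ^ k)" if "C \<subseteq> {..<n}" for C
        using that by (intro sum.mono_neutral_cong_right) auto
      with AB show ?thesis by (simp add: e_def left_diff_distrib sum_subtractf)
    qed
    also have "l ^ n / l * (D * (1 / l / 2) ^ n) = D / l / 2 ^ n"
      using l by (simp add: field_simps power_divide power_mult_distrib)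
    finally show "D / l / 2 ^ n \<le> \<bar>(\<Sum>k\<in>A. l ^ k) - (\<Sum>k\<in>B. l ^ k)\<bar>" .
  qed
qed

subsection \<open>The attractor and its mesh count\<close>

text \<open>Half-open squares partition the plane, so each point determines its square by two
  floors.\<close>

lemma mesh_count_eq_card_image:
  assumes "\<delta> > 0"
  shows "mesh_count \<delta> E = card ((\<lambda>p. (\<lfloor>fst p / \<delta>\<rfloor>, \<lfloor>snd p / \<delta>\<rfloor>)) ` E)"
proof -
  have "(of_int i * \<delta> \<le> x \<and> x < (of_int i + 1) * \<delta>) \<longleftrightarrow> \<lfloor>x / \<delta>\<rfloor> = i" for i :: int and x :: real
    using assms by (simp add: floor_eq_iff pos_le_divide_eq pos_divide_less_eq)
  hence "{(i, j). \<exists>p \<in> E. real_of_int i * \<delta> \<le> fst p \<and> fst p < (real_of_int i + 1) * \<delta> \<and>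
      real_of_int j * \<delta> \<le> snd p \<and> snd p < (real_of_int j + 1) * \<delta>} =
      {(i, j). \<exists>p \<in> E. \<lfloor>fst p / \<delta>\<rfloor> = i \<and> \<lfloor>snd p / \<delta>\<rfloor> = j}"
    by (simp only: conj_assoc[symmetric])
  also have "\<dots> = (\<lambda>p. (\<lfloor>fst p / \<delta>\<rfloor>, \<lfloor>snd p / \<delta>\<rfloor>)) ` E" by auto
  finally show ?thesis by (simp add: mesh_count_def)
qed

text \<open>Images of the origin under the compositions of \<open>n\<close> of the two contractions; the set
  \<open>A\<close> holds the positions at which the second one is used.\<close>

definition level_points :: "real \<Rightarrow> nat \<Rightarrow> real set" where
  "level_points l n = (\<lambda>A. (1 - l) * (\<Sum>k\<in>A. l ^ k)) ` Pow {..<n}"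

lemma level_points_0: "level_points l 0 = {0}"
  by (simp add: level_points_def)

text \<open>Position \<open>0\<close> belongs to the outermost contraction: shifting all positions
  by \<open>Suc\<close> multiplies the sum by \<open>l\<close>, and inserting \<open>0\<close> adds
  the translation \<open>1 - l\<close>.\<close>

lemma level_points_Suc:
  "level_points l (Suc n) =
     (\<lambda>x. l * x) ` level_points l n \<union> (\<lambda>x. l * x + (1 - l)) ` level_points l n"
proof -
  have fin: "finite A" if "A \<in> Pow {..<n}" for A using that finite_subset by auto
  have shift: "(1 - l) * (\<Sum>k\<in>Suc ` A. l ^ k) = l * ((1 - l) * (\<Sum>k\<in>A. l ^ k))" for A
    by (simp add: sum.reindex sum_distrib_left mult_ac)
  have shift1: "(1 - l) * sum ((^) l) (insert 0 (Suc ` A)) =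
      l * ((1 - l) * sum ((^) l) A) + (1 - l)" if "A \<in> Pow {..<n}" for A
    using fin[OF that] shift[of A] by (subst sum.insert) (auto simp: algebra_simps)
  have "Pow {..<Suc n} = (`) Suc ` Pow {..<n} \<union> (\<lambda>A. insert 0 (Suc ` A)) ` Pow {..<n}"
    by (simp only: lessThan_Suc_eq_insert_0 Pow_insert image_Pow_surj[OF refl, symmetric] image_image)
  hence "level_points l (Suc n) =
      (\<lambda>A. (1 - l) * (\<Sum>k\<in>Suc ` A. l ^ k)) ` Pow {..<n} \<union>
      (\<lambda>A. (1 - l) * sum ((^) l) (insert 0 (Suc ` A))) ` Pow {..<n}"
    by (simp only: level_points_def image_Un image_image)
  also have "(\<lambda>A. (1 - l) * (\<Sum>k\<in>Suc ` A. l ^ k)) ` Pow {..<n} = (\<lambda>x. l * x) ` level_points l n"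
    by (simp only: level_points_def image_image shift)
  also have "(\<lambda>A. (1 - l) * sum ((^) l) (insert 0 (Suc ` A))) ` Pow {..<n} =
      (\<lambda>x. l * x + (1 - l)) ` level_points l n"
    unfolding level_points_def image_image by (intro image_cong refl shift1)
  finally show ?thesis .
qed

lemma finite_level_points: "finite (level_points l n)"
  by (simp add: level_points_def)

lemma card_level_points_le: "card (level_points l n) \<le> 2 ^ n"
  using card_image_le[of "Pow {..<n}"] by (simp add: level_points_def card_Pow)

lemma power2_interval:
  fixes x :: real
  assumes "1 \<le> x"
  obtains n where "2 ^ n \<le> x" "x < 2 ^ (n + 1)"
proof -
  obtain N where "x < 2 ^ N" using real_arch_pow[of 2 x] by auto
  with assms obtain n where "\<forall>i\<le>n. \<not> x < 2 ^ i" "x < 2 ^ Suc n"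
    using ex_least_nat_less[of "\<lambda>n. x < 2 ^ n" N] by auto
  thus thesis by (intro that[of n]) auto
qed

lemma card_atLeast0_floor:
  fixes t :: real
  assumes "t \<ge> 0"
  shows "t \<le> real (card {0..\<lfloor>t\<rfloor>})" "real (card {0..\<lfloor>t\<rfloor>}) \<le> t + 1"
  using assms by (auto simp: of_nat_nat)

section \<open>Geometry of the attractor\<close>

locale inhomogeneous_attractor =
  fixes l :: real and F :: "(real \<times> real) set"
  assumes l: "0 < l" "l < 1"
    and F_nonempty: "F \<noteq> {}" and F_compact: "compact F"
    and F_eq: "F = S0 l ` F \<union> S1 l ` F \<union> condC"
begin

lemma F_cases:
  assumes "p \<in> F"
  obtains (S0) q where "q \<in> F" "fst p = l * fst q" "snd p = l * snd q"
  | (S1) q where "q \<in> F" "fst p = l * fst q + (1 - l)" "snd p = l * snd q"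
  | (C) "fst p = 0" "0 \<le> snd p" "snd p \<le> 1"
proof -
  have "p \<in> S0 l ` F \<union> S1 l ` F \<union> condC" using assms F_eq by simp
  thus thesis by (auto simp: S0_def S1_def condC_def split_beta intro: that)
qed

text \<open>By compactness each coordinate attains its extrema on \<open>F\<close>. An extremum
  outside the unit interval could not come from \<open>condC\<close>, and both contractions move
  such values strictly inwards, contradicting extremality.\<close>

lemma subset_unit_square: "F \<subseteq> {0..1} \<times> {0..1}"
proof -
  have snd_le: "snd p \<le> 1" if "p \<in> F" for p
  proof -
    obtain m where m: "m \<in> F" "\<And>q. q \<in> F \<Longrightarrow> snd q \<le> snd m"
      using continuous_attains_sup[OF F_compact F_nonempty continuous_on_snd[OF continuous_on_id]] by blast
    have *: "l * snd q \<le> l * snd m" if "q \<in> F" for q using m(2)[OF that] l by simp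
    have "snd m \<le> 1"
    proof (rule ccontr)
      assume "\<not> snd m \<le> 1"
      hence **: "snd m > 1" by simp
      hence lt: "l * snd m < snd m"
        using mult_strict_right_mono[OF l(2), of "snd m"] by (simp_all add: algebra_simps)
      from m(1) show False
      proof (cases rule: F_cases)
        case (S0 q)
        thus ?thesis using *[of q] lt by linarith
      next
        case (S1 q)
        thus ?thesis using *[of q] lt by linarith
      next
        case C
        thus ?thesis using ** by linarith
      qed
    qed
    thus ?thesis using m(2)[OF that] by simp
  qed
  have fst_le: "fst p \<le> 1" if "p \<in> F" for p
  proof -
    obtain m where m: "m \<in> F" "\<And>q. q \<in> F \<Longrightarrow> fst q \<le> fst m"
      using continuous_attains_sup[OF F_compact F_nonempty continuous_on_fst[OF continuous_on_id]] by blast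
    have *: "l * fst q \<le> l * fst m" if "q \<in> F" for q using m(2)[OF that] l by simp
    have "fst m \<le> 1"
    proof (rule ccontr)
      assume "\<not> fst m \<le> 1"
      hence **: "fst m > 1" by simp
      hence lt: "l * fst m < fst m" "l * fst m + (1 - l) < fst m"
        using mult_strict_right_mono[OF l(2), of "fst m"] mult_strict_left_mono[OF **, of "1 - l"] l
        by (simp_all add: algebra_simps)
      from m(1) show False
      proof (cases rule: F_cases)
        case (S0 q)
        thus ?thesis using *[of q] lt by linarith
      next
        case (S1 q)
        thus ?thesis using *[of q] lt by linarith
      next
        case C
        thus ?thesis using ** by linarith
      qed
    qed
    thus ?thesis using m(2)[OF that] by simp
  qed
  have snd_ge: "snd p \<ge> 0" if "p \<in> F" for p
  proof -
    obtain m where m: "m \<in> F" "\<And>q. q \<in> F \<Longrightarrow> snd q \<ge> snd m"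
      using continuous_attains_inf[OF F_compact F_nonempty continuous_on_snd[OF continuous_on_id]] by blast
    have *: "l * snd q \<ge> l * snd m" if "q \<in> F" for q using m(2)[OF that] l by simp
    have "snd m \<ge> 0"
    proof (rule ccontr)
      assume "\<not> snd m \<ge> 0"
      hence **: "snd m < 0" by simp
      hence lt: "l * snd m > snd m"
        using mult_strict_right_mono_neg[OF l(2), of "snd m"] by simp
      from m(1) show False
      proof (cases rule: F_cases)
        case (S0 q)
        thus ?thesis using *[of q] lt by linarith
      next
        case (S1 q)
        thus ?thesis using *[of q] lt by linarith
      next
        case C
        thus ?thesis using ** by linarith
      qed
    qed
    thus ?thesis using m(2)[OF that] by simp
  qed
  have fst_ge: "fst p \<ge> 0" if "p \<in> F" for p
  proof -
    obtain m where m: "m \<in> F" "\<And>q. q \<in> F \<Longrightarrow> fst q \<ge> fst m"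
      using continuous_attains_inf[OF F_compact F_nonempty continuous_on_fst[OF continuous_on_id]] by blast
    have *: "l * fst q \<ge> l * fst m" if "q \<in> F" for q using m(2)[OF that] l by simp
    have "fst m \<ge> 0"
    proof (rule ccontr)
      assume "\<not> fst m \<ge> 0"
      hence **: "fst m < 0" by simp
      hence lt: "l * fst m > fst m"
        using mult_strict_right_mono_neg[OF l(2), of "fst m"] by simp
      from m(1) show False
      proof (cases rule: F_cases)
        case (S0 q)
        thus ?thesis using *[of q] lt by linarith
      next
        case (S1 q)
        thus ?thesis using *[of q] lt l by linarith
      next
        case C
        thus ?thesis using ** by linarith
      qed
    qed
    thus ?thesis using m(2)[OF that] by simp
  qed
  show ?thesis using snd_le fst_le snd_ge fst_ge by (force simp: mem_Times_iff)
qed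

lemma columns_subset: "level_points l n \<times> {0..l ^ n} \<subseteq> F"
proof (induction n)
  case 0
  have "condC \<subseteq> F" using F_eq by blast
  thus ?case by (simp add: level_points_0 condC_def)
next
  case (Suc n)
  show ?case
  proof
    fix p assume p: "p \<in> level_points l (Suc n) \<times> {0..l ^ Suc n}"
    obtain x y where xy: "p = (x, y)" by fastforce
    have y: "y / l \<in> {0..l ^ n}" using p l by (auto simp: xy field_simps)
    from p consider u where "u \<in> level_points l n" "x = l * u"
      | u where "u \<in> level_points l n" "x = l * u + (1 - l)"
      by (auto simp: xy level_points_Suc)
    thus "p \<in> F"
    proof cases
      case 1
      hence "(u, y / l) \<in> F" using Suc y by blast
      hence "S0 l (u, y / l) \<in> F" using F_eq by blast
      thus ?thesis using 1 l by (simp add: S0_def xy)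
    next
      case 2
      hence "(u, y / l) \<in> F" using Suc y by blast
      hence "S1 l (u, y / l) \<in> F" using F_eq by blast
      thus ?thesis using 2 l by (simp add: S1_def xy)
    qed
  qed
qed

text \<open>This unfolds \<open>F_eq\<close> \<open>n\<close> times: words of length
  \<open>k < n\<close> applied to \<open>condC\<close> give the columns, and words of length
  \<open>n\<close> applied to \<open>F\<close> stay in the strip of height
  \<open>l ^ n\<close>.\<close>

lemma subset_columns:
  "F \<subseteq> (\<Union>k<n. level_points l k \<times> {0..l ^ k}) \<union> {0..1} \<times> {0..l ^ n}"
proof (induction n)
  case 0
  show ?case using subset_unit_square by simp
next
  case (Suc n)
  show ?case
  proof
    fix p assume p: "p \<in> F"
    have scale: "p \<in> (\<Union>k<Suc n. level_points l k \<times> {0..l ^ k}) \<union> {0..1} \<times> {0..l ^ Suc n}"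
      if q: "q \<in> F" "snd p = l * snd q" "fst p = l * fst q \<or> fst p = l * fst q + (1 - l)" for q
    proof -
      have step: "snd p \<in> {0..l ^ Suc k}" if "snd q \<in> {0..l ^ k}" for k
        using that q(2) l by simp
      have "q \<in> (\<Union>k<n. level_points l k \<times> {0..l ^ k}) \<union> {0..1} \<times> {0..l ^ n}"
        using Suc q(1) by (rule subsetD)
      then consider k where "k < n" "fst q \<in> level_points l k" "snd q \<in> {0..l ^ k}"
        | "snd q \<in> {0..l ^ n}"
        unfolding Un_iff UN_iff mem_Times_iff by blast
      thus ?thesis
      proof cases
        case (1 k)
        have "fst p \<in> level_points l (Suc k)"
          using 1(2) q(3) unfolding level_points_Suc by blast
        with step[OF 1(3)] 1(1) have "Suc k < Suc n" "p \<in> level_points l (Suc k) \<times> {0..l ^ Suc k}"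
          by (simp_all only: mem_Times_iff Suc_less_eq)
        thus ?thesis by blast
      next
        case 2
        moreover have "fst p \<in> {0..1}" using p subset_unit_square by auto
        ultimately have "p \<in> {0..1} \<times> {0..l ^ Suc n}" using step[of n] by (simp add: mem_Times_iff)
        thus ?thesis by blast
      qed
    qed
    from p show "p \<in> (\<Union>k<Suc n. level_points l k \<times> {0..l ^ k}) \<union> {0..1} \<times> {0..l ^ Suc n}"
    proof (cases rule: F_cases)
      case C
      hence "p \<in> level_points l 0 \<times> {0..l ^ 0}" by (simp add: mem_Times_iff level_points_0)
      thus ?thesis by blast
    next
      case (S0 q)
      thus ?thesis by (intro scale[of q]) simp_all
    next
      case (S1 q)
      thus ?thesis by (intro scale[of q]) simp_all
    qed
  qed
qed

section \<open>Counting mesh squares\<close>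

text \<open>The columns contribute a geometric series of ratio \<open>2 * l > 1\<close>, comparable
  to its last term; this gives the summand with denominator \<open>2 * l - 1\<close>. The strip
  gives the summand \<open>4\<close>.\<close>

lemma mesh_count_upper:
  assumes "l > 1/2" "\<delta> > 0" "2 ^ n \<le> 1 / \<delta>"
  shows "mesh_count \<delta> F \<le> (2 / (2 * l - 1) + 4) * l ^ n / \<delta> ^ 2"
proof -
  let ?f = "\<lambda>x. \<lfloor>x / \<delta>\<rfloor>"
  let ?g = "\<lambda>p. (?f (fst p), ?f (snd p))"
  let ?I = "\<lambda>t :: real. {0..\<lfloor>t / \<delta>\<rfloor>}"
  let ?U = "\<lambda>k. ?f ` level_points l k \<times> ?I (l ^ k)"
  have "?f x \<in> ?I t" if "x \<in> {0..t}" for x t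
    using that assms by (auto intro!: floor_mono divide_right_mono)
  hence img: "?g ` (X \<times> {0..t}) \<subseteq> ?f ` X \<times> ?I t"
    and img1: "?g ` ({0..1} \<times> {0..t}) \<subseteq> ?I 1 \<times> ?I t" for X t
    by auto
  have "?g ` F \<subseteq> ?g ` ((\<Union>k<n. level_points l k \<times> {0..l ^ k}) \<union> {0..1} \<times> {0..l ^ n})"
    by (intro image_mono subset_columns)
  also have "\<dots> \<subseteq> (\<Union>k<n. ?U k) \<union> ?I 1 \<times> ?I (l ^ n)"
    unfolding image_Un image_UN by (intro Un_mono UN_mono img img1 subset_refl)
  finally have "card (?g ` F) \<le> card ((\<Union>k<n. ?U k) \<union> ?I 1 \<times> ?I (l ^ n))"
    by (intro card_mono) (auto simp: finite_level_points)
  also have "\<dots> \<le> (\<Sum>k<n. card (?U k)) + card (?I 1 \<times> ?I (l ^ n))"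
    by (intro order.trans[OF card_Un_le] add_mono card_UN_le) auto
  finally have "mesh_count \<delta> F \<le> (\<Sum>k<n. card (?U k)) + card (?I 1 \<times> ?I (l ^ n))"
    using assms(2) by (simp add: mesh_count_eq_card_image)
  hence "real (mesh_count \<delta> F) \<le> real ((\<Sum>k<n. card (?U k)) + card (?I 1 \<times> ?I (l ^ n)))"
    by (rule of_nat_mono)
  also have "\<dots> = (\<Sum>k<n. real (card (?U k))) + real (card (?I 1)) * real (card (?I (l ^ n)))"
    by (simp add: card_cartesian_product)
  also have "\<dots> \<le> (\<Sum>k<n. 2 / \<delta> * (2 * l) ^ k) + (2 / \<delta>) * (2 * l ^ n / \<delta>)"
  proof -
    \<comment> \<open>For \<open>t\<close> at least \<delta> the additive \<open>1\<close> in the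
      count is absorbed by doubling.\<close>
    have I: "real (card (?I t)) \<le> 2 * t / \<delta>" if "\<delta> \<le> t" for t
    proof -
      have "1 \<le> t / \<delta>" using that assms(2) by simp
      moreover from this have "real (card (?I t)) \<le> t / \<delta> + 1"
        by (intro card_atLeast0_floor(2)) simp
      ultimately show ?thesis by linarith
    qed
    \<comment> \<open>Here \<open>l > 1/2\<close> ensures that columns of all levels up to
      \<open>n\<close> are at least one mesh width high.\<close>
    have pow: "\<delta> \<le> l ^ k" if "k \<le> n" for k
    proof -
      have "\<delta> \<le> (1/2) ^ n" using assms by (simp add: field_simps)
      also have "\<dots> \<le> (1/2) ^ k" using that by (intro power_decreasing) auto
      also have "\<dots> \<le> l ^ k" using assms by (intro power_mono) auto
      finally show ?thesis .
    qed
    have "\<delta> \<le> 1" using pow[of 0] by simp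
    have "real (card (?U k)) \<le> 2 / \<delta> * (2 * l) ^ k" if "k < n" for k
    proof -
      have "card (?f ` level_points l k) \<le> 2 ^ k"
        using card_image_le[OF finite_level_points] card_level_points_le by (rule order.trans)
      hence "real (card (?f ` level_points l k)) \<le> real (2 ^ k)" by (rule of_nat_mono)
      hence "real (card (?U k)) \<le> 2 ^ k * (2 * l ^ k / \<delta>)"
        unfolding card_cartesian_product of_nat_mult
        using I[OF pow[of k]] that by (intro mult_mono) simp_all
      thus ?thesis by (simp add: power_mult_distrib mult_ac)
    qed
    moreover have "real (card (?I 1)) \<le> 2 / \<delta>" using I[OF \<open>\<delta> \<le> 1\<close>] by simp
    moreover have "real (card (?I (l ^ n))) \<le> 2 * l ^ n / \<delta>" using I[OF pow[of n]] by simp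
    ultimately show ?thesis using assms(2)
      by (intro add_mono sum_mono mult_mono) simp_all
  qed
  also have "(\<Sum>k<n. 2 / \<delta> * (2 * l) ^ k) = 2 / \<delta> * (((2 * l) ^ n - 1) / (2 * l - 1))"
    unfolding sum_distrib_left[symmetric] using assms(1) by (subst geometric_sum) auto
  also have "\<dots> \<le> 2 / \<delta> * ((1 / \<delta> * l ^ n) / (2 * l - 1))"
  proof -
    have "2 ^ n * l ^ n \<le> 1 / \<delta> * l ^ n" using assms l by (intro mult_right_mono) auto
    thus ?thesis using assms by (intro mult_left_mono divide_right_mono) (auto simp: power_mult_distrib)
  qed
  also have "2 / \<delta> * ((1 / \<delta> * l ^ n) / (2 * l - 1)) + (2 / \<delta>) * (2 * l ^ n / \<delta>) =
      (2 / (2 * l - 1) + 4) * l ^ n / \<delta> ^ 2"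
    by (simp add: power2_eq_square distrib_right add_divide_distrib)
  finally show ?thesis by simp
qed

text \<open>Points at distance at least \<delta> have different floors, so the \<open>2 ^ n\<close>
  columns of level \<open>n\<close> lie in distinct mesh columns, and each meets at least
  \<open>l ^ n / \<delta>\<close> squares.\<close>

lemma mesh_count_lower:
  assumes sep: "\<And>A B. A \<subseteq> {..<n} \<Longrightarrow> B \<subseteq> {..<n} \<Longrightarrow> A \<noteq> B \<Longrightarrow>
      \<delta> \<le> \<bar>(1 - l) * (\<Sum>k\<in>A. l ^ k) - (1 - l) * (\<Sum>k\<in>B. l ^ k)\<bar>"
    and "\<delta> > 0"
  shows "(2 * l) ^ n / \<delta> \<le> mesh_count \<delta> F"
proof -
  let ?f = "\<lambda>x. \<lfloor>x / \<delta>\<rfloor>"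
  let ?g = "\<lambda>p. (?f (fst p), ?f (snd p))"
  let ?I = "\<lambda>t :: real. {0..\<lfloor>t / \<delta>\<rfloor>}"
  define x where "x A = (1 - l) * (\<Sum>k\<in>A. l ^ k)" for A
  have "inj_on (\<lambda>A. ?f (x A)) (Pow {..<n})"
  proof (rule inj_onI, rule ccontr)
    fix A B assume *: "A \<in> Pow {..<n}" "B \<in> Pow {..<n}" "?f (x A) = ?f (x B)" "A \<noteq> B"
    hence "\<delta> \<le> \<bar>x A - x B\<bar>" using sep unfolding x_def by simp
    hence "1 \<le> \<bar>x A / \<delta> - x B / \<delta>\<bar>"
      using \<open>\<delta> > 0\<close> by (simp add: diff_divide_distrib[symmetric] abs_divide)
    thus False using *(3) by linarith
  qed
  hence card1: "card ((\<lambda>A. ?f (x A)) ` Pow {..<n}) = 2 ^ n"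
    by (simp add: card_image card_Pow)
  have "(\<lambda>A. ?f (x A)) ` Pow {..<n} \<times> ?I (l ^ n) \<subseteq> ?g ` F"
  proof
    fix s assume "s \<in> (\<lambda>A. ?f (x A)) ` Pow {..<n} \<times> ?I (l ^ n)"
    then obtain A j where s: "s = (?f (x A), j)" "A \<subseteq> {..<n}" "0 \<le> j" "j \<le> \<lfloor>l ^ n / \<delta>\<rfloor>" by auto
    have "of_int j \<le> l ^ n / \<delta>" using s(4) by (simp add: le_floor_iff)
    \<comment> \<open>The witness in row \<open>j\<close> is taken at the lower edge, which belongs
      to the half-open square.\<close>
    hence "of_int j * \<delta> \<in> {0..l ^ n}" using \<open>\<delta> > 0\<close> s(3) by (simp add: field_simps)
    hence "(x A, of_int j * \<delta>) \<in> F"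
      using columns_subset[of n] s(2) by (auto simp: level_points_def x_def)
    moreover have "?g (x A, of_int j * \<delta>) = s" using s(1) \<open>\<delta> > 0\<close> by simp
    ultimately show "s \<in> ?g ` F" by (rule rev_image_eqI[OF _ sym])
  qed
  moreover have "finite (?g ` F)"
  proof (rule finite_subset)
    show "?g ` F \<subseteq> ?I 1 \<times> ?I 1"
    proof
      fix s assume "s \<in> ?g ` F"
      then obtain p where "p \<in> F" "s = ?g p" by blast
      moreover from this have "fst p \<in> {0..1}" "snd p \<in> {0..1}" using subset_unit_square by auto
      ultimately show "s \<in> ?I 1 \<times> ?I 1"
        using \<open>\<delta> > 0\<close> by (auto intro!: floor_mono divide_right_mono)
    qed
  qed auto
  ultimately have "card ((\<lambda>A. ?f (x A)) ` Pow {..<n} \<times> ?I (l ^ n)) \<le> mesh_count \<delta> F"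
    unfolding mesh_count_eq_card_image[OF \<open>\<delta> > 0\<close>] by (intro card_mono)
  hence "real (2 ^ n * card (?I (l ^ n))) \<le> mesh_count \<delta> F"
    unfolding card_cartesian_product card1 by (rule of_nat_mono)
  hence "2 ^ n * real (card (?I (l ^ n))) \<le> mesh_count \<delta> F"
    by (simp only: of_nat_mult of_nat_power of_nat_numeral)
  moreover have "2 ^ n * (l ^ n / \<delta>) \<le> 2 ^ n * real (card (?I (l ^ n)))"
    using l \<open>\<delta> > 0\<close> by (intro mult_left_mono card_atLeast0_floor(1)) auto
  ultimately show ?thesis by (simp add: power_mult_distrib)
qed

lemma mesh_count_asymptotics:
  assumes "1/2 < l" "c > 0"
    and sep: "\<And>n A B. A \<subseteq> {..<n} \<Longrightarrow> B \<subseteq> {..<n} \<Longrightarrow> A \<noteq> B \<Longrightarrow>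
       c / 2 ^ n \<le> \<bar>(\<Sum>k\<in>A. l ^ k) - (\<Sum>k\<in>B. l ^ k)\<bar>"
  shows "(\<lambda>\<delta>. ln (real (mesh_count \<delta> F)) / (- ln \<delta>) - ln (4 * l) / ln 2)
           \<in> O[at_right 0](\<lambda>\<delta>. 1 / (- ln \<delta>))"
proof -
  define s where "s = ln (4 * l) / ln 2"
  have "ln (4 :: real) = 2 * ln 2" using ln_realpow[of 2 2] by simp
  \<comment> \<open>The first form matches \<open>l ^ n / \<delta> ^ 2\<close> in the upper bound,
    the second \<open>(2 * l) ^ m / \<delta>\<close> in the lower one.\<close>
  hence s1: "s = 2 + ln l / ln 2" and s2: "s = 1 + ln (2 * l) / ln 2"
    using l by (simp_all add: s_def ln_mult field_simps)
  define c' where "c' = (1 - l) * c"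
  have "c' > 0" using assms(2) l by (simp add: c'_def)
  define K where "K = 2 / (2 * l - 1) + 4"
  have "K > 0" using assms(1) by (simp add: K_def pos_add_strict)
  \<comment> \<open>\<open>B1\<close> and \<open>B2\<close> collect the multiplicative constants and
    the loss of at most one level when a real exponent is replaced by \<open>n\<close> or
    \<open>m\<close>.\<close>
  define B1 where "B1 = ln K - ln l"
  define B2 where "B2 = (ln c' / ln 2 - 1) * ln (2 * l)"
  have bound: "ln (mesh_count \<delta> F) \<le> s * (- ln \<delta>) + B1 \<and> s * (- ln \<delta>) + B2 \<le> ln (mesh_count \<delta> F)"
    if \<delta>: "0 < \<delta>" "\<delta> < 1" "\<delta> \<le> c'" for \<delta>
  proof -
    \<comment> \<open>Two different levels near \<open>log 2 (1 / \<delta>)\<close>: the upper bound needs at most \<open>1 / \<delta>\<close>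
      points, the lower bound needs points that are \<open>\<delta>\<close>-separated.\<close>
    have "1 \<le> 1 / \<delta>" using \<delta> by simp
    then obtain n where n: "2 ^ n \<le> 1 / \<delta>" "1 / \<delta> < 2 ^ (n + 1)"
      by (rule power2_interval)
    have "1 \<le> c' / \<delta>" using \<delta> by simp
    then obtain m where m: "2 ^ m \<le> c' / \<delta>" "c' / \<delta> < 2 ^ (m + 1)"
      by (rule power2_interval)
    have lower: "(2 * l) ^ m / \<delta> \<le> mesh_count \<delta> F"
    proof (rule mesh_count_lower)
      fix A B :: "nat set" assume AB: "A \<subseteq> {..<m}" "B \<subseteq> {..<m}" "A \<noteq> B"
      have "\<delta> \<le> c' / 2 ^ m" using m(1) \<delta> by (simp add: field_simps)
      also have "\<dots> = (1 - l) * (c / 2 ^ m)" by (simp add: c'_def)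
      also have "\<dots> \<le> (1 - l) * \<bar>(\<Sum>k\<in>A. l ^ k) - (\<Sum>k\<in>B. l ^ k)\<bar>"
        using sep[OF AB] l by (intro mult_left_mono) auto
      also have "\<dots> = \<bar>(1 - l) * (\<Sum>k\<in>A. l ^ k) - (1 - l) * (\<Sum>k\<in>B. l ^ k)\<bar>"
        using l by (simp add: right_diff_distrib[symmetric] abs_mult)
      finally show "\<delta> \<le> \<bar>(1 - l) * (\<Sum>k\<in>A. l ^ k) - (1 - l) * (\<Sum>k\<in>B. l ^ k)\<bar>" .
    qed (use \<delta> in auto)
    have pos: "0 < (2 * l) ^ m / \<delta>" using l \<delta> by simp
    \<comment> \<open>Positivity is needed to compare logarithms of the count.\<close>
    hence mesh_pos: "0 < real (mesh_count \<delta> F)" using lower by linarith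
    have "ln (mesh_count \<delta> F) \<le> ln (K * l ^ n / \<delta> ^ 2)"
      using mesh_count_upper[OF assms(1) \<delta>(1) n(1)] mesh_pos by (simp add: K_def)
    also have "\<dots> = ln K + n * ln l - 2 * ln \<delta>"
      using \<open>K > 0\<close> l \<delta> by (simp add: ln_mult ln_div ln_realpow)
    finally have up: "ln (mesh_count \<delta> F) \<le> ln K + n * ln l - 2 * ln \<delta>" .
    have "ln (1 / \<delta>) < ln (2 ^ (n + 1))" using n \<delta> by (subst ln_less_cancel_iff) auto
    hence "- ln \<delta> < (n + 1) * ln 2" using \<delta> by (simp add: ln_div ln_realpow del: power_Suc)
    hence "- ln \<delta> / ln 2 - 1 \<le> n" by (simp add: field_simps)
    \<comment> \<open>Since \<open>ln l\<close> is negative, the lower bound on \<open>n\<close>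
      becomes an upper bound here.\<close>
    hence "n * ln l \<le> (- ln \<delta> / ln 2 - 1) * ln l" using l by (intro mult_right_mono_neg) auto
    hence "ln (mesh_count \<delta> F) \<le> s * (- ln \<delta>) + B1"
      using up by (simp add: s1 B1_def algebra_simps)
    moreover have "s * (- ln \<delta>) + B2 \<le> ln (mesh_count \<delta> F)"
    proof -
      have "ln (c' / \<delta>) < ln (2 ^ (m + 1))" using m \<delta> \<open>c' > 0\<close> by (subst ln_less_cancel_iff) auto
      hence "ln c' - ln \<delta> < (m + 1) * ln 2"
        using \<delta> \<open>c' > 0\<close> by (simp add: ln_div ln_realpow del: power_Suc)
      hence "(ln c' - ln \<delta>) / ln 2 - 1 \<le> m" by (simp add: field_simps)
      hence "((ln c' - ln \<delta>) / ln 2 - 1) * ln (2 * l) \<le> m * ln (2 * l)"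
        using assms(1) by (intro mult_right_mono) auto
      moreover have "m * ln (2 * l) - ln \<delta> = ln ((2 * l) ^ m / \<delta>)"
        using l \<delta> by (simp add: ln_div ln_realpow[symmetric])
      moreover have "\<dots> \<le> ln (mesh_count \<delta> F)" using lower pos mesh_pos by simp
      moreover have "s * (- ln \<delta>) + B2 = ((ln c' - ln \<delta>) / ln 2 - 1) * ln (2 * l) - ln \<delta>"
        unfolding s2 B2_def by (simp add: algebra_simps diff_divide_distrib)
      ultimately show ?thesis by linarith
    qed
    ultimately show ?thesis by blast
  qed
  show ?thesis
  proof (rule bigoI)
    show "\<forall>\<^sub>F \<delta> in at_right 0. norm (ln (real (mesh_count \<delta> F)) / - ln \<delta> - ln (4 * l) / ln 2)
        \<le> (\<bar>B1\<bar> + \<bar>B2\<bar>) * norm (1 / - ln \<delta>)"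
    proof (rule eventually_at_rightI)
      \<comment> \<open>Below \<open>1\<close> the denominator \<open>- ln \<delta>\<close> is
        positive; below \<open>c'\<close> the level \<open>m\<close> exists.\<close>
      show "0 < min 1 c'" using \<open>c' > 0\<close> by simp
      fix \<delta> assume \<delta>: "\<delta> \<in> {0<..<min 1 c'}"
      hence L: "- ln \<delta> > 0" by simp
      have "\<bar>ln (mesh_count \<delta> F) - s * (- ln \<delta>)\<bar> \<le> \<bar>B1\<bar> + \<bar>B2\<bar>"
        using bound[of \<delta>] \<delta> by auto
      hence "\<bar>ln (mesh_count \<delta> F) - s * (- ln \<delta>)\<bar> / (- ln \<delta>) \<le> (\<bar>B1\<bar> + \<bar>B2\<bar>) / (- ln \<delta>)"
        using L by (intro divide_right_mono) auto
      moreover have "ln (mesh_count \<delta> F) / (- ln \<delta>) - s =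
          (ln (mesh_count \<delta> F) - s * (- ln \<delta>)) / (- ln \<delta>)"
        using L by (simp add: diff_divide_distrib add_divide_distrib)
      moreover have "norm (1 / - ln \<delta>) = 1 / - ln \<delta>" using L by simp
      ultimately show "norm (ln (real (mesh_count \<delta> F)) / - ln \<delta> - ln (4 * l) / ln 2)
          \<le> (\<bar>B1\<bar> + \<bar>B2\<bar>) * norm (1 / - ln \<delta>)"
        unfolding s_def[symmetric] real_norm_def using abs_of_pos[OF L]
        by (simp only: abs_divide times_divide_eq_right mult_1_right)
    qed
  qed
qed

end

theorem theorem2p4:
  fixes l :: real and F :: "(real \<times> real) set"
  assumes "1/2 < l" "l < 1" "garsia_number (1 / l)"
    and "F \<noteq> {}" "compact F"
    and "F = S0 l ` F \<union> S1 l ` F \<union> condC"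
  shows "(\<lambda>\<delta>. ln (real (mesh_count \<delta> F)) / (- ln \<delta>) - ln (4 * l) / ln 2)
           \<in> O[at_right 0](\<lambda>\<delta>. 1 / (- ln \<delta>))"
proof -
  interpret inhomogeneous_attractor l F
    using assms by unfold_locales auto
  obtain c where "c > 0" "\<And>n A B. A \<subseteq> {..<n} \<Longrightarrow> B \<subseteq> {..<n} \<Longrightarrow> A \<noteq> B \<Longrightarrow>
      c / 2 ^ n \<le> \<bar>(\<Sum>k\<in>A. l ^ k) - (\<Sum>k\<in>B. l ^ k)\<bar>"
    using garsia_digit_sums_separated[OF assms(3)] by metis
  with assms(1) show ?thesis by (rule mesh_count_asymptotics)
qed

end
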